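(* Let $\mathcal{K}^{\langle\infty\rangle}$ be a planar unbounded simple nested fractal generated by $N$ similitudes with $k\ge3$ essential fixed points, and assume that there are no inessential fixed points, i.e. $k=N$. Then $\mathcal{K}^{\langle\infty\rangle}$ has the good labelling property.
   Context: Setting: $L>1$, $N\ge2$, $\nu_1=0,\dots,\nu_N\in\mathbb{R}^2$, $\Psi_i(x)=x/L+\nu_i$, and $\mathcal{K}^{\langle 0\rangle}=\bigcup_i\Psi_i(\mathcal{K}^{\langle 0\rangle})$ is a planar simple nested fractal (essential fixed points $V_0^{\langle0\rangle}$: fixed points $x$ for which there are another fixed point $y$ and $\Psi_i\ne\Psi_j$ with $\Psi_i(x)=\Psi_j(y)$; open set condition, nesting, symmetry with respect to perpendicular bisectors of pairs of essential fixed points, connectivity); $k=\#V_0^{\langle0\rangle}$, and $V_0^{\langle0\rangle}$ spans a regular $k$-gon. $\mathcal{K}^{\langle M\rangle}=L^M\mathcal{K}^{\langle 0\rangle}$, $\mathcal{K}^{\langle\infty\rangle}=\bigcup_{M\ge0}\mathcal{K}^{\langle M\rangle}$. An $M$-complex is $\Delta_M=\mathcal{K}^{\langle M\rangle}+\nu_{\Delta_M}$ with $\nu_{\Delta_M}=\sum_{j=M+1}^{J}L^j\nu_{i_j}$ ($J\ge M+1$), vertex set $V(\Delta_M)=L^MV_0^{\langle0\rangle}+\nu_{\Delta_M}$; $V_M^{\langle M\rangle}=L^MV_0^{\langle0\rangle}$ and $V_M^{\langle\infty\rangle}$ is the union of all $V(\Delta_M)$. With $\mathcal{A}$ an alphabet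 of $k$ symbols and $\mathcal{R}_M$ the $k$ rotations about the barycenter of $\mathcal{K}^{\langle M\rangle}$ preserving $V_M^{\langle M\rangle}$, a good labelling function of order $M$ is $\ell_M:V_M^{\langle\infty\rangle}\to\mathcal{A}$, bijective on $V_M^{\langle M\rangle}$, such that for each $M$-complex $\Delta_M=\mathcal{K}^{\langle M\rangle}+\nu_{\Delta_M}$ there is $R_{\Delta_M}\in\mathcal{R}_M$ with $\ell_M(v)=\ell_M(R_{\Delta_M}(v-\nu_{\Delta_M}))$, $v\in V(\Delta_M)$. The good labelling property means that a good labelling function of some order $M\in\mathbb{Z}$ exists. *)

theory Defs
  imports "HOL-Analysis.Analysis"
begin

text \<open>The plane is modelled by the type complex. The similitudes are indexed by 1..N.\<close>

definition Psi :: "real \<Rightarrow> (nat \<Rightarrow> complex) \<Rightarrow> nat \<Rightarrow> complex \<Rightarrow> complex" where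
  "Psi L \<nu> i x = x / complex_of_real L + \<nu> i"

definition Psi_word :: "real \<Rightarrow> (nat \<Rightarrow> complex) \<Rightarrow> nat list \<Rightarrow> complex \<Rightarrow> complex" where
  "Psi_word L \<nu> w = foldr (\<lambda>i f. Psi L \<nu> i \<circ> f) w id"

definition fixed_points :: "real \<Rightarrow> nat \<Rightarrow> (nat \<Rightarrow> complex) \<Rightarrow> complex set" where
  "fixed_points L N \<nu> = {x. \<exists>i\<in>{1..N}. Psi L \<nu> i x = x}"

definition V0 :: "real \<Rightarrow> nat \<Rightarrow> (nat \<Rightarrow> complex) \<Rightarrow> complex set" where
  "V0 L N \<nu> = {x \<in> fixed_points L N \<nu>. \<exists>y\<in>fixed_points L N \<nu>. \<exists>i\<in>{1..N}. \<exists>j\<in>{1..N}.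
      Psi L \<nu> i \<noteq> Psi L \<nu> j \<and> Psi L \<nu> i x = Psi L \<nu> j y}"

definition Vn :: "real \<Rightarrow> nat \<Rightarrow> (nat \<Rightarrow> complex) \<Rightarrow> nat \<Rightarrow> complex set" where
  "Vn L N \<nu> n = \<Union>{Psi_word L \<nu> w ` V0 L N \<nu> | w. length w = n \<and> set w \<subseteq> {1..N}}"

definition bisector_reflection :: "complex \<Rightarrow> complex \<Rightarrow> complex \<Rightarrow> complex" where
  "bisector_reflection x y z =
     (let u = (y - x) /\<^sub>R norm (y - x); m = (x + y) /\<^sub>R 2 in z - (2 * ((z - m) \<bullet> u)) *\<^sub>R u)"

definition simple_nested_fractal ::
  "real \<Rightarrow> nat \<Rightarrow> (nat \<Rightarrow> complex) \<Rightarrow> complex set \<Rightarrow> bool" where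
  "simple_nested_fractal L N \<nu> K \<longleftrightarrow>
     L > 1 \<and> N \<ge> 2 \<and> \<nu> 1 = 0 \<and>
     \<comment> \<open>K is the attractor of the IFS\<close>
     compact K \<and> K \<noteq> {} \<and> K = (\<Union>i\<in>{1..N}. Psi L \<nu> i ` K) \<and>
     \<comment> \<open>at least two essential fixed points\<close>
     card (V0 L N \<nu>) \<ge> 2 \<and>
     \<comment> \<open>open set condition\<close>
     (\<exists>U. open U \<and> bounded U \<and> U \<noteq> {} \<and> (\<forall>i\<in>{1..N}. Psi L \<nu> i ` U \<subseteq> U) \<and>
        (\<forall>i\<in>{1..N}. \<forall>j\<in>{1..N}. i \<noteq> j \<longrightarrow> Psi L \<nu> i ` U \<inter> Psi L \<nu> j ` U = {})) \<and>
     \<comment> \<open>nesting\<close>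
     (\<forall>w w'. length w = length w' \<and> set w \<subseteq> {1..N} \<and> set w' \<subseteq> {1..N} \<and> w \<noteq> w' \<longrightarrow>
        Psi_word L \<nu> w ` K \<inter> Psi_word L \<nu> w' ` K =
        Psi_word L \<nu> w ` V0 L N \<nu> \<inter> Psi_word L \<nu> w' ` V0 L N \<nu>) \<and>
     \<comment> \<open>symmetry\<close>
     (\<forall>x\<in>V0 L N \<nu>. \<forall>y\<in>V0 L N \<nu>. x \<noteq> y \<longrightarrow>
        (\<forall>n. bisector_reflection x y ` Vn L N \<nu> n \<subseteq> Vn L N \<nu> n)) \<and>
     \<comment> \<open>connectivity: 1-cells form a connected chain graph\<close>
     (\<forall>i\<in>{1..N}. \<forall>j\<in>{1..N}.
        (\<lambda>a b. a \<in> {1..N} \<and> b \<in> {1..N} \<and> Psi L \<nu> a ` K \<inter> Psi L \<nu> b ` K \<noteq> {})\<^sup>*\<^sup>* i j)"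

definition regular_polygon :: "complex set \<Rightarrow> nat \<Rightarrow> bool" where
  "regular_polygon V k \<longleftrightarrow> (\<exists>c r \<theta>. r > 0 \<and>
     V = {c + complex_of_real r * cis (\<theta> + 2 * pi * real j / real k) | j. j < k})"

definition complex_shifts :: "real \<Rightarrow> nat \<Rightarrow> (nat \<Rightarrow> complex) \<Rightarrow> int \<Rightarrow> complex set" where
  "complex_shifts L N \<nu> M = {(\<Sum>j\<in>{M+1..J}. complex_of_real (L powi j) * \<nu> (w j)) | J w.
      J \<ge> M + 1 \<and> (\<forall>j. w j \<in> {1..N})}"

definition VMM :: "real \<Rightarrow> nat \<Rightarrow> (nat \<Rightarrow> complex) \<Rightarrow> int \<Rightarrow> complex set" where
  "VMM L N \<nu> M = (\<lambda>v. complex_of_real (L powi M) * v) ` V0 L N \<nu>"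

definition complex_vertices :: "real \<Rightarrow> nat \<Rightarrow> (nat \<Rightarrow> complex) \<Rightarrow> int \<Rightarrow> complex \<Rightarrow> complex set" where
  "complex_vertices L N \<nu> M s = (\<lambda>v. v + s) ` VMM L N \<nu> M"

definition VM_inf :: "real \<Rightarrow> nat \<Rightarrow> (nat \<Rightarrow> complex) \<Rightarrow> int \<Rightarrow> complex set" where
  "VM_inf L N \<nu> M = (\<Union>s\<in>complex_shifts L N \<nu> M. complex_vertices L N \<nu> M s)"

text \<open>Barycenter of K^{<M>}; by symmetry it is the centre of the polygon V_M^{<M>}.\<close>
definition barycenter_M :: "real \<Rightarrow> nat \<Rightarrow> (nat \<Rightarrow> complex) \<Rightarrow> int \<Rightarrow> complex" where
  "barycenter_M L N \<nu> M = (\<Sum>v\<in>VMM L N \<nu> M. v) / of_nat (card (VMM L N \<nu> M))"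

definition rotations_M :: "real \<Rightarrow> nat \<Rightarrow> (nat \<Rightarrow> complex) \<Rightarrow> int \<Rightarrow> (complex \<Rightarrow> complex) set" where
  "rotations_M L N \<nu> M = {R. \<exists>\<omega>. cmod \<omega> = 1 \<and>
      R = (\<lambda>z. barycenter_M L N \<nu> M + \<omega> * (z - barycenter_M L N \<nu> M)) \<and>
      R ` VMM L N \<nu> M = VMM L N \<nu> M}"

definition good_labelling_function ::
  "real \<Rightarrow> nat \<Rightarrow> (nat \<Rightarrow> complex) \<Rightarrow> 'a set \<Rightarrow> int \<Rightarrow> (complex \<Rightarrow> 'a) \<Rightarrow> bool" where
  "good_labelling_function L N \<nu> A M lab \<longleftrightarrow>
     (\<forall>v\<in>VM_inf L N \<nu> M. lab v \<in> A) \<and>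
     bij_betw lab (VMM L N \<nu> M) A \<and>
     (\<forall>s\<in>complex_shifts L N \<nu> M. \<exists>R\<in>rotations_M L N \<nu> M.
        \<forall>v\<in>complex_vertices L N \<nu> M s. lab v = lab (R (v - s)))"

definition good_labelling_property :: "real \<Rightarrow> nat \<Rightarrow> (nat \<Rightarrow> complex) \<Rightarrow> bool" where
  "good_labelling_property L N \<nu> \<longleftrightarrow>
     (\<exists>M::int. \<exists>lab::complex \<Rightarrow> nat.
        good_labelling_function L N \<nu> {..<card (V0 L N \<nu>)} M lab)"

end

theory Submission
  imports Defs
begin

text \<open>Normalise the polygon to the \<open>k\<close>-th roots of unity. All fixed points are essential, so the
  cells are the homothetic images of \<open>K\<close> at the vertices \<open>a\<close>. Suppose that the distinct cells \<open>a\<close>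
  and \<open>b\<close> share a vertex, which is the vertex \<open>p\<close> of the first and \<open>q\<close> of the second. By symmetry and
  nesting, the bisector of \<open>a\<close> and \<open>b\<close> meets cell \<open>a\<close> in that vertex only. Since \<open>K\<close> is connected and the
  circulant graph of cells has no cut vertex, the cell lies on one side of the bisector. Hence
  \<open>p\<close> and \<open>q\<close> span a longest diagonal, the ratio \<open>b / a\<close> is \<open>\<delta>\<close> or \<open>1 / \<delta>\<close> for one generator
  \<open>\<delta>\<close> of the roots of unity, and for some \<open>m\<close> always \<open>p * a ^ m = q * b ^ m\<close>. Therefore the label
  \<open>p * (\<Prod>j\<ge>1. a\<^sub>j ^ (m * (m + 1) ^ (j - 1)))\<close> of the vertex \<open>p\<close> of the complex with address
  \<open>(a\<^sub>1, a\<^sub>2, \<dots>)\<close> depends only on the point, and it rotates with the complex.\<close>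

section \<open>Chords of the unit circle and non-cut vertices\<close>

abbreviation roots :: "nat \<Rightarrow> complex set" where
  "roots k \<equiv> {z. z ^ k = 1}"

lemma non_cut_vertex:
  fixes E :: "'a \<Rightarrow> 'a \<Rightarrow> bool"
  assumes "finite V" "x0 \<in> V"
    and conn: "\<And>x. x \<in> V \<Longrightarrow> E\<^sup>*\<^sup>* x0 x"
    and field: "\<And>x y. E x y \<Longrightarrow> x \<in> V \<and> y \<in> V"
  shows "\<exists>v\<in>V. \<forall>col :: 'a \<Rightarrow> bool. (\<forall>x y. E x y \<longrightarrow> x \<noteq> v \<longrightarrow> y \<noteq> v \<longrightarrow> col x = col y) \<longrightarrow>
           (\<forall>x\<in>V - {v}. \<forall>y\<in>V - {v}. col x = col y)"
proof -
  define rank where "rank x = (LEAST n. (E ^^ n) x0 x)" for x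
  have rank: "(E ^^ rank x) x0 x" if "x \<in> V" for x
    unfolding rank_def using conn[OF that] by (metis LeastI rtranclp_imp_relpowp)
  have rank_le: "rank x \<le> n" if "(E ^^ n) x0 x" for x n
    unfolding rank_def by (rule Least_le) (rule that)
  have "finite (rank ` V)" "rank ` V \<noteq> {}" using assms by auto
  then obtain v where v: "v \<in> V" "\<And>x. x \<in> V \<Longrightarrow> rank x \<le> rank v"
    using Max_in[of "rank ` V"] Max_ge[of "rank ` V"] by fastforce
  have "col x = col x0"
    if col: "\<And>x y. E x y \<Longrightarrow> x \<noteq> v \<Longrightarrow> y \<noteq> v \<Longrightarrow> col x = col y" and "x \<in> V - {v}"
    for col :: "'a \<Rightarrow> bool" and x
    using that(2)
  proof (induction "rank x" arbitrary: x rule: less_induct)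
    case less
    show ?case
    proof (cases "rank x")
      case 0
      then show ?thesis using rank[of x] less.prems by simp
    next
      case (Suc n)
      then obtain y where y: "(E ^^ n) x0 y" "E y x"
        using rank[of x] less.prems by auto
      have "rank y < rank x" using rank_le[OF y(1)] Suc by simp
      moreover have "y \<in> V" using field y(2) by blast
      moreover have "y \<noteq> v" using calculation v(2)[of x] less.prems by auto
      ultimately show ?thesis using less.hyps[of y] col[OF y(2)] less.prems by auto
    qed
  qed
  then show ?thesis
    by (intro bexI[OF _ v(1)] allI impI ballI) (metis (full_types))
qed

text \<open>In normalised coordinates this is the similitude of ratio \<open>1 / L\<close> about
  \<open>a\<close>; cells are named by these fixed points.\<close>

definition phi :: "real \<Rightarrow> complex \<Rightarrow> complex \<Rightarrow> complex" where
  "phi L a w = (1 - 1 / of_real L) * a + w / of_real L"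

section \<open>Products and reflections on the unit circle\<close>

lemma cnj_root: "norm (z :: complex) = 1 \<Longrightarrow> cnj z = 1 / z"
  using complex_norm_square[of z] by (cases "z = 0") (auto simp: field_simps)

lemma norm_roots: "z \<in> roots k \<Longrightarrow> k > 0 \<Longrightarrow> norm z = 1"
  using power_eq_1_iff[of z k] by auto

text \<open>Conjugation inverts unit numbers, so the conjugate of the chord \<open>q - p\<close> is
  \<open>- (q - p) / (p * q)\<close>. The ratio of two parallel chords is real, which forces equal
  products of endpoints.\<close>

lemma parallel_chords:
  fixes a b p q :: complex
  assumes "norm a = 1" "norm b = 1" "norm p = 1" "norm q = 1"
    and "a \<noteq> b" "t \<noteq> 0" and eq: "q - p = of_real t * (a - b)"
  shows "p * q = a * b"
proof -
  have nz: "a \<noteq> 0" "b \<noteq> 0" "p \<noteq> 0" "q \<noteq> 0" using assms by auto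
  have "cnj (q - p) = of_real t * cnj (a - b)" by (simp only: eq complex_cnj_mult complex_cnj_complex_of_real)
  then have "1 / q - 1 / p = of_real t * (1 / a - 1 / b)"
    unfolding complex_cnj_diff by (simp only: assms(1-4) cnj_root)
  then have "(p - q) * (a * b) = (of_real t * (b - a)) * (p * q)"
    using nz by (simp add: field_simps)
  also have "of_real t * (b - a) = p - q" using eq by (simp add: algebra_simps)
  finally have "(p - q) * (p * q - a * b) = 0" by (simp add: algebra_simps)
  moreover have "p \<noteq> q" using eq assms by auto
  ultimately show ?thesis by simp
qed

text \<open>Taking \<open>u\<close> to \<open>a * b * cnj u\<close> is the reflection that swaps
  \<open>a\<close> and \<open>b\<close>; its axis consists of the vectors orthogonal to
  \<open>a - b\<close>.\<close>

lemma fixed_by_reflection: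
  fixes a b u :: complex
  assumes "norm a = 1" "norm b = 1" "a \<noteq> b" and "Re (u * cnj (a - b)) = 0"
  shows "u = a * b * cnj u"
proof -
  have nz: "a \<noteq> 0" "b \<noteq> 0" using assms by auto
  have "u * cnj (a - b) + cnj (u * cnj (a - b)) = 0"
    unfolding complex_add_cnj assms(4) by simp
  then have "u * (1 / a - 1 / b) + cnj u * (a - b) = 0"
    unfolding complex_cnj_mult complex_cnj_cnj unfolding complex_cnj_diff complex_cnj_cnj by (simp only: assms(1,2) cnj_root)
  moreover have "(b - a) * (u - a * b * cnj u) = a * b * (u * (1 / a - 1 / b) + cnj u * (a - b))"
    using nz by (simp add: field_simps)
  ultimately have "(b - a) * (u - a * b * cnj u) = 0" by simp
  then show ?thesis using assms(3) by simp
qed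

lemma sum_sq_one: "norm (z :: complex) = 1 \<Longrightarrow> (Re z)\<^sup>2 + (Im z)\<^sup>2 = 1"
  by (simp add: cmod_def)

text \<open>If \<open>Re e2 < Re e1\<close>, then \<open>e2\<close> or \<open>cnj e2\<close> lies on
  a closed half circle that starts at \<open>1\<close> and contains \<open>e1\<close>, beyond
  \<open>e1\<close>. By Thales the angle at \<open>e1\<close> between that point and
  \<open>1\<close> is not acute.\<close>

lemma acute_imp_Re_le:
  assumes "norm e1 = 1" "norm e2 = 1"
    and acute: "\<And>z. z \<in> {e2, cnj e2} \<Longrightarrow> z \<noteq> e1 \<Longrightarrow> Re ((z - e1) * cnj (1 - e1)) > 0"
  shows "Re e1 \<le> Re e2"
proof (rule ccontr)
  assume "\<not> ?thesis"
  then have lt: "Re e2 < Re e1" by simp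
  obtain z where z: "z \<in> {e2, cnj e2}" "Im z * Im e1 \<ge> 0"
  proof (cases "Im e2 * Im e1 \<ge> 0")
    case False
    then show ?thesis using that[of "cnj e2"] by simp
  qed (use that[of e2] in simp)
  define a b s t where "a = Re e1" and "b = Re z" and "s = Im e1" and "t = Im z"
  have ba: "b < a" using z lt by (auto simp: a_def b_def)
  have sq: "a\<^sup>2 + s\<^sup>2 = 1" "b\<^sup>2 + t\<^sup>2 = 1"
    using sum_sq_one[OF assms(1)] sum_sq_one[of z] z assms(2) by (auto simp: a_def b_def s_def t_def)
  have "\<bar>a\<bar> \<le> 1" "\<bar>b\<bar> \<le> 1"
    using abs_Re_le_cmod[of e1] abs_Re_le_cmod[of z] z assms(1,2) by (auto simp: a_def b_def)
  \<comment> \<open>After squaring and eliminating \<open>s\<close> and \<open>t\<close> by the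
    circle equation, a common factor leaves
    \<open>(1 - a) * (1 + b) \<le> (1 + a) * (1 - b)\<close>, that is
    \<open>b \<le> a\<close>.\<close>
  have st: "(1 - a) * (1 + b) \<le> t * s"
  proof (rule power2_le_imp_le)
    have "(1 - a) * (1 + b) \<le> (1 + a) * (1 - b)" using ba by (simp add: algebra_simps)
    then have "((1 - a) * (1 + b)) * ((1 - a) * (1 + b)) \<le> ((1 - a) * (1 + b)) * ((1 + a) * (1 - b))"
      using \<open>\<bar>a\<bar> \<le> 1\<close> \<open>\<bar>b\<bar> \<le> 1\<close> by (intro mult_left_mono) auto
    also have "\<dots> = (1 - a\<^sup>2) * (1 - b\<^sup>2)" by (simp add: algebra_simps power2_eq_square)
    also have "\<dots> = s\<^sup>2 * t\<^sup>2" proof -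
      have "1 - a\<^sup>2 = s\<^sup>2" "1 - b\<^sup>2 = t\<^sup>2" using sq by simp_all
      then show ?thesis by simp
    qed
    finally show "((1 - a) * (1 + b))\<^sup>2 \<le> (t * s)\<^sup>2" by (simp add: power2_eq_square algebra_simps)
    show "0 \<le> t * s" using z by (simp add: s_def t_def)
  qed
  have "Re ((z - e1) * cnj (1 - e1)) = (1 - a) * (1 + b) - t * s + (a\<^sup>2 + s\<^sup>2 - 1)"
    by (simp add: a_def b_def s_def t_def algebra_simps power2_eq_square)
  then have "Re ((z - e1) * cnj (1 - e1)) \<le> 0" using st sq by simp
  moreover have "z \<noteq> e1" using ba by (auto simp: a_def b_def)
  ultimately show False using acute[OF z(1)] by simp
qed

section \<open>Normalised attractors\<close>

lemma phi_diff: "phi L a w - phi L a w' = (w - w') / of_real L"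
  by (simp add: phi_def diff_divide_distrib)

lemma phi_fixed: "phi L a a = a"
  by (simp add: phi_def algebra_simps)

lemma phi_mult: "phi L (c * a) (c * w) = c * phi L a w"
  by (simp add: phi_def algebra_simps)

lemma phi_reflect: "c * cnj (phi L a w) = phi L (c * cnj a) (c * cnj w)"
  by (simp add: phi_def algebra_simps)

lemma root_mult: "a \<in> roots k \<Longrightarrow> b \<in> roots k \<Longrightarrow> a * b \<in> roots k"
  by (simp add: power_mult_distrib)

lemma root_cnj: "a \<in> roots k \<Longrightarrow> cnj a \<in> roots k"
  by (metis complex_cnj_one complex_cnj_power mem_Collect_eq)

lemma root_divide: "a \<in> roots k \<Longrightarrow> b \<in> roots k \<Longrightarrow> a / b \<in> roots k"
  by (simp add: power_divide)

locale polygon_ifs =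
  fixes L :: real and k :: nat and K :: "complex set"
  assumes L: "L > 1" and k: "k \<ge> 3"
    and compact_K: "compact K" and K_ne: "K \<noteq> {}"
    and K_eq: "K = (\<Union>a\<in>roots k. phi L a ` K)"
    and nesting: "\<lbrakk>a \<in> roots k; b \<in> roots k; a \<noteq> b\<rbrakk> \<Longrightarrow>
      phi L a ` K \<inter> phi L b ` K \<subseteq> phi L a ` roots k \<inter> phi L b ` roots k"
    and chain: "\<lbrakk>a \<in> roots k; b \<in> roots k\<rbrakk> \<Longrightarrow>
      (\<lambda>a b. a \<in> roots k \<and> b \<in> roots k \<and> phi L a ` K \<inter> phi L b ` K \<noteq> {})\<^sup>*\<^sup>* a b"
begin

abbreviation V :: "complex set" where "V \<equiv> roots k"
abbreviation \<phi> :: "complex \<Rightarrow> complex \<Rightarrow> complex" where "\<phi> \<equiv> phi L"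

lemma norm_V: "a \<in> V \<Longrightarrow> norm a = 1"
  using norm_roots k by (metis gr0I not_numeral_le_zero)

lemma V_nz: "a \<in> V \<Longrightarrow> a \<noteq> 0"
  using norm_V by force

lemma finite_V: "finite V" and card_V: "card V = k"
  using k by (auto intro: finite_nth_roots card_roots_unity_eq)

lemma continuous_on_phi: "continuous_on S (\<phi> a)"
  unfolding phi_def using L by (intro continuous_intros) auto

lemma phi_inj: "\<phi> a w = \<phi> a w' \<longleftrightarrow> w = w'"
  using L by (simp add: phi_def)

lemma phi_K: "a \<in> V \<Longrightarrow> w \<in> K \<Longrightarrow> \<phi> a w \<in> K"
  using K_eq by blast

lemma dist_phi: "dist (\<phi> a w) (\<phi> a w') = dist w w' / L"
  using L by (simp add: dist_norm phi_diff norm_divide)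

text \<open>The largest distance from \<open>C\<close> to \<open>D\<close> is attained at some
  \<open>\<phi> a y\<close> with \<open>y\<close> in \<open>C\<close>, where it is at most
  \<open>1 / L\<close> times the distance of \<open>y\<close>; hence it is zero.\<close>

lemma attractor_subset:
  assumes "compact C" and C: "C \<subseteq> (\<Union>a\<in>V. \<phi> a ` C)"
    and "closed D" "D \<noteq> {}" and D: "\<And>a w. a \<in> V \<Longrightarrow> w \<in> D \<Longrightarrow> \<phi> a w \<in> D"
  shows "C \<subseteq> D"
proof (cases "C = {}")
  case False
  have "continuous_on C (\<lambda>x. infdist x D)" by (intro continuous_intros)
  then obtain x where x: "x \<in> C" "\<And>y. y \<in> C \<Longrightarrow> infdist y D \<le> infdist x D"
    using continuous_attains_sup[OF \<open>compact C\<close> False, of "\<lambda>x. infdist x D"] by auto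
  obtain a y where a: "a \<in> V" "y \<in> C" "x = \<phi> a y" using C x(1) by blast
  obtain z where z: "z \<in> D" "infdist y D = dist y z"
    using infdist_attains_inf[OF \<open>closed D\<close> \<open>D \<noteq> {}\<close>] by blast
  have "infdist x D \<le> dist x (\<phi> a z)" by (rule infdist_le) (rule D[OF a(1) z(1)])
  also have "\<dots> = infdist y D / L" by (simp add: a dist_phi z)
  also have "\<dots> \<le> infdist x D / L" using x(2)[OF a(2)] L by (simp add: divide_right_mono)
  finally have "infdist x D * (L - 1) \<le> 0" using L by (simp add: field_simps)
  then have "infdist x D \<le> 0" using L by (simp add: mult_le_0_iff)
  then have "infdist y D = 0" if "y \<in> C" for y
    using x(2)[OF that] infdist_nonneg[of y D] by linarith
  then show ?thesis
    using in_closed_iff_infdist_zero[OF \<open>closed D\<close> \<open>D \<noteq> {}\<close>] by blast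
qed simp

lemma V_subset_K: "V \<subseteq> K"
proof
  fix a assume "a \<in> V"
  moreover have "a \<in> \<phi> a ` {a}" by (simp add: phi_fixed)
  ultimately have "{a} \<subseteq> (\<Union>b\<in>V. \<phi> b ` {a})" by blast
  then have "{a} \<subseteq> K"
    by (rule attractor_subset[OF compact_insert[OF compact_empty] _ compact_imp_closed[OF compact_K] K_ne phi_K])
  then show "a \<in> K" by simp
qed

text \<open>The reflection turns the similitude at \<open>b\<close> into the one at
  \<open>c * cnj b\<close>, so the reflected \<open>K\<close> is again covered by its own
  cells.\<close>

lemma reflect_K:
  assumes c: "c \<in> V" and w: "w \<in> K" shows "c * cnj w \<in> K"
proof -
  have "(\<lambda>w. c * cnj w) ` K \<subseteq> K"
  proof (rule attractor_subset[OF _ _ compact_imp_closed[OF compact_K] K_ne phi_K])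
    show "compact ((\<lambda>w. c * cnj w) ` K)"
      by (intro compact_continuous_image continuous_intros compact_K)
    show "(\<lambda>w. c * cnj w) ` K \<subseteq> (\<Union>a\<in>V. \<phi> a ` (\<lambda>w. c * cnj w) ` K)"
    proof clarify
      fix w assume "w \<in> K"
      then obtain b y where b: "b \<in> V" "y \<in> K" "w = \<phi> b y" using K_eq by blast
      have "c * cnj w = \<phi> (c * cnj b) (c * cnj y)" by (simp add: b phi_reflect)
      moreover have "c * cnj b \<in> V" using root_mult[OF c root_cnj[OF b(1)]] .
      ultimately show "c * cnj w \<in> (\<Union>a\<in>V. \<phi> a ` (\<lambda>w. c * cnj w) ` K)"
        using b(2) by blast
    qed
  qed
  then show ?thesis using w by blast
qed

text \<open>A splitting of \<open>K\<close> at distance \<open>\<delta>\<close> splits some first-level cell, and rescaling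
  that cell yields a splitting of \<open>K\<close> at distance \<open>L * \<delta>\<close>.\<close>
lemma connected_K: "connected K"
proof (rule ccontr)
  define split where "split \<delta> \<longleftrightarrow> (\<exists>A B. A \<union> B = K \<and> A \<noteq> {} \<and> B \<noteq> {} \<and>
      (\<forall>x\<in>A. \<forall>y\<in>B. \<delta> \<le> dist x y))" for \<delta>
  assume "\<not> ?thesis"
  then obtain A B where AB: "closed A" "closed B" "A \<noteq> {}" "B \<noteq> {}" "A \<union> B = K" "A \<inter> B = {}"
    using connected_closed_set[OF compact_imp_closed[OF compact_K]] by metis
  have "A = K \<inter> A" using AB(5) by blast
  then have "compact A" using compact_Int_closed[OF compact_K AB(1)] by simp
  then obtain \<delta> where "\<delta> > 0" "\<forall>x\<in>A. \<forall>y\<in>B. \<delta> \<le> dist x y"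
    using separate_compact_closed[of A B] AB by blast
  then have \<delta>: "\<delta> > 0" "split \<delta>"
    unfolding split_def using AB by blast+
  have step: "split (L * \<delta>)" if sp: "split \<delta>" for \<delta>
  proof -
    obtain A B where AB: "A \<union> B = K" "A \<noteq> {}" "B \<noteq> {}"
      and d: "\<And>x y. x \<in> A \<Longrightarrow> y \<in> B \<Longrightarrow> \<delta> \<le> dist x y"
      using sp unfolding split_def by blast
    \<comment> \<open>If every cell met only one of \<open>A\<close> and \<open>B\<close>, a chain
      of intersecting cells could not lead from a cell meeting \<open>A\<close> to one meeting
      \<open>B\<close>.\<close>
    have "\<exists>a\<in>V. \<phi> a ` K \<inter> A \<noteq> {} \<and> \<phi> a ` K \<inter> B \<noteq> {}"
    proof (rule ccontr)
      assume no: "\<not> ?thesis"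
      obtain x y where "x \<in> A" "y \<in> B" using AB by auto
      then obtain a b where ab: "a \<in> V" "x \<in> \<phi> a ` K" "b \<in> V" "y \<in> \<phi> b ` K"
        using K_eq AB(1) by blast
      have "\<phi> b ` K \<inter> A \<noteq> {}"
        using chain[OF ab(1,3)]
      proof (induction rule: rtranclp_induct)
        case base
        then show ?case using ab \<open>x \<in> A\<close> by blast
      next
        case (step c e)
        then obtain z where z: "z \<in> \<phi> c ` K" "z \<in> \<phi> e ` K" "c \<in> V" by blast
        then have "z \<in> K" using phi_K by blast
        moreover have "z \<notin> B" using no step.IH z by blast
        ultimately show ?case using z(2) AB(1) by blast
      qed
      then show False using no ab \<open>y \<in> B\<close> by blast
    qed
    then obtain a where a: "a \<in> V" "\<phi> a ` K \<inter> A \<noteq> {}" "\<phi> a ` K \<inter> B \<noteq> {}" by blast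
    have "L * \<delta> \<le> dist x y" if "\<phi> a x \<in> A" "\<phi> a y \<in> B" for x y
      using d[OF that] L by (simp add: dist_phi field_simps)
    moreover have "{x \<in> K. \<phi> a x \<in> A} \<union> {x \<in> K. \<phi> a x \<in> B} = K"
      using phi_K[OF a(1)] AB(1) by blast
    moreover have "{x \<in> K. \<phi> a x \<in> A} \<noteq> {}" "{x \<in> K. \<phi> a x \<in> B} \<noteq> {}"
      using a(2,3) by blast+
    ultimately show ?thesis
      unfolding split_def
      by (intro exI[of _ "{x \<in> K. \<phi> a x \<in> A}"] exI[of _ "{x \<in> K. \<phi> a x \<in> B}"]) simp
  qed
  have "split (L ^ n * \<delta>)" for n
  proof (induction n)
    case (Suc n)
    then show ?case using step[OF Suc] by (simp add: mult.assoc)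
  qed (use \<delta> in simp)
  \<comment> \<open>Enough rescalings separate two points of \<open>K\<close> by more than its
    diameter.\<close>
  moreover obtain n where n: "diameter K / \<delta> < L ^ n"
    using real_arch_pow[OF L] by blast
  ultimately have "split (L ^ n * \<delta>)" by simp
  then obtain x y where "x \<in> K" "y \<in> K" "L ^ n * \<delta> \<le> dist x y"
    unfolding split_def by blast
  moreover have "dist x y \<le> diameter K"
    using diameter_bounded_bound[OF compact_imp_bounded[OF compact_K]] calculation by simp
  ultimately show False using n \<delta> by (simp add: field_simps)
qed

text \<open>The circle is strictly convex and \<open>\<phi> a w\<close> is a proper convex
  combination of \<open>a\<close> and \<open>w\<close>; the proof uses the equality case of the
  triangle inequality.\<close>

lemma phi_in_V_imp_eq:
  assumes "a \<in> V" "w \<in> V" "\<phi> a w \<in> V" shows "w = a"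
proof -
  have na: "norm a = 1" and nw: "norm w = 1" and n: "norm (\<phi> a w) = 1" using assms norm_V by auto
  have "of_real L * \<phi> a w = of_real (L - 1) * a + w"
    using L by (simp add: phi_def field_simps)
  then have "norm (of_real (L - 1) * a + w) = L"
    using n L by (metis abs_of_pos less_trans mult.right_neutral norm_mult norm_of_real zero_less_one)
  then have "norm (of_real (L - 1) * a + w) = norm (of_real (L - 1) * a) + norm w"
    using na nw L by (simp add: norm_mult del: of_real_diff)
  then have "norm (of_real (L - 1) * a) *\<^sub>R w = norm w *\<^sub>R (of_real (L - 1) * a)"
    using norm_triangle_eq by blast
  then have "of_real (L - 1) * w = of_real (L - 1) * a"
    using na nw L by (simp add: norm_mult scaleR_conv_of_real del: of_real_diff)
  then show ?thesis using L by simp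
qed

end

section \<open>Touching cells\<close>

text \<open>The centre projects to the midpoint of a chord. So the vector \<open>q - p\<close> alone
  determines the projection of \<open>p\<close> onto its direction.\<close>

lemma Re_mult_chord:
  assumes "norm p = 1" "norm q = 1"
  shows "Re (p * cnj (q - p)) = - (norm (q - p))\<^sup>2 / 2"
  using sum_sq_one[OF assms(1)] sum_sq_one[OF assms(2)]
  unfolding cmod_power2 by (simp add: power2_eq_square algebra_simps)

context polygon_ifs
begin

definition touch :: "complex \<Rightarrow> complex \<Rightarrow> complex \<Rightarrow> complex \<Rightarrow> bool" where
  "touch a b p q \<longleftrightarrow> a \<in> V \<and> b \<in> V \<and> p \<in> V \<and> q \<in> V \<and> a \<noteq> b \<and> \<phi> a p = \<phi> b q"

text \<open>Loops are included because the chain condition also relates a cell to itself.\<close>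

definition adj :: "complex \<Rightarrow> complex \<Rightarrow> bool" where
  "adj a b \<longleftrightarrow> a \<in> V \<and> b \<in> V \<and> (a = b \<or> (\<exists>p q. touch a b p q))"

lemma touch_sym: "touch a b p q \<Longrightarrow> touch b a q p"
  by (auto simp: touch_def)

lemma touch_rotate: "touch a b p q \<Longrightarrow> c \<in> V \<Longrightarrow> touch (c * a) (c * b) (c * p) (c * q)"
  unfolding touch_def by (simp add: phi_mult power_mult_distrib del: mem_Collect_eq add: root_mult V_nz)

lemma adj_rotate: "adj a b \<Longrightarrow> c \<in> V \<Longrightarrow> adj (c * a) (c * b)"
  unfolding adj_def using touch_rotate root_mult by metis

lemma chain_adj:
  assumes "a \<in> V" "b \<in> V" shows "adj\<^sup>*\<^sup>* a b"
proof -
  have "adj x y" if "x \<in> V \<and> y \<in> V \<and> \<phi> x ` K \<inter> \<phi> y ` K \<noteq> {}" for x y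
  proof (cases "x = y")
    case False
    then have "\<phi> x ` V \<inter> \<phi> y ` V \<noteq> {}" using nesting[of x y] that by blast
    then show ?thesis unfolding adj_def touch_def using that False by blast
  qed (use that in \<open>simp add: adj_def\<close>)
  then show ?thesis by (rule mono_rtranclp[rule_format, OF _ chain[OF assms]])
qed

lemma touch_diff: "touch a b p q \<Longrightarrow> q - p = of_real (L - 1) * (a - b)"
  using L by (simp add: touch_def phi_def field_simps)

lemma touch_ne: "touch a b p q \<Longrightarrow> p \<noteq> q"
  using L touch_diff[of a b p q] by (auto simp: touch_def)

lemma touch_prod:
  assumes "touch a b p q" shows "p * q = a * b"
  using parallel_chords[of a b p q "L - 1"] touch_diff[OF assms] assms L
  by (auto simp: touch_def norm_V simp del: mem_Collect_eq)

text \<open>For touching cells the vertex \<open>\<phi> a p\<close> lies on the bisector of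
  \<open>a\<close> and \<open>b\<close>, which passes through \<open>0\<close>. The sign of
  \<open>side a b p w\<close> thus tells on which side of it \<open>\<phi> a w\<close> lies,
  positive being the side of \<open>a\<close>.\<close>

definition side :: "complex \<Rightarrow> complex \<Rightarrow> complex \<Rightarrow> complex \<Rightarrow> real" where
  "side a b p w = Re ((w - p) * cnj (a - b))"

lemma side_phi: "side a b p (\<phi> p w) = side a b p w / L"
proof -
  have "(\<phi> p w - p) * cnj (a - b) = ((w - p) * cnj (a - b)) / of_real L"
    using phi_diff[of L p w p] by (simp only: phi_fixed times_divide_eq_left)
  then show ?thesis unfolding side_def by (simp only: Re_divide_of_real)
qed

text \<open>The points of \<open>K\<close> with \<open>side a b p w = 0\<close> correspond to the points of the cell \<open>\<phi> a ` K\<close>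
  on the bisector of \<open>a\<close> and \<open>b\<close>. The reflection in that bisector swaps the two cells.\<close>
lemma touch_line_in_V:
  assumes t: "touch a b p q" and w: "w \<in> K" "side a b p w = 0"
  shows "w \<in> V"
proof -
  have ab: "a \<in> V" "b \<in> V" "a \<noteq> b" "p \<in> V" "q \<in> V" using t by (auto simp: touch_def)
  have fixed: "w - p = a * b * cnj (w - p)"
    by (rule fixed_by_reflection[OF norm_V[OF ab(1)] norm_V[OF ab(2)] ab(3) w(2)[unfolded side_def]])
  have pq: "a * b * cnj p = q"
  proof -
    have "a * b * cnj p = q * (p * cnj p)" by (simp flip: touch_prod[OF t])
    also have "p * cnj p = 1" using complex_norm_square[of p] norm_V[OF ab(4)] by simp
    finally show ?thesis by simp
  qed
  \<comment> \<open>Starting from the common vertex, the point \<open>\<phi> a w\<close> is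
    rewritten as a point of the cell at \<open>b\<close>, namely its own mirror image.\<close>
  have "\<phi> a w = \<phi> a p + (w - p) / L" using phi_diff[of L a w p] by (simp add: algebra_simps)
  also have "\<phi> a p = \<phi> b q" using t by (simp add: touch_def)
  also have "w - p = a * b * cnj w - q" using fixed pq by (simp add: algebra_simps)
  finally have "\<phi> a w = \<phi> b (a * b * cnj w)" using phi_diff[of L b "a * b * cnj w" q] by (simp add: algebra_simps)
  moreover have "a * b * cnj w \<in> K" using reflect_K[OF root_mult[OF ab(1,2)] w(1)] .
  ultimately have "\<phi> a w \<in> \<phi> a ` K \<inter> \<phi> b ` K"
    using w(1) by (metis IntI imageI)
  then have "\<phi> a w \<in> \<phi> a ` V" using nesting[OF ab(1-3)] by blast
  then obtain v where "v \<in> V" "\<phi> a w = \<phi> a v" by (rule imageE)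
  then show ?thesis unfolding phi_inj by simp
qed

text \<open>Contracting \<open>w\<close> towards \<open>p\<close> stays on the line, so both
  \<open>w\<close> and \<open>\<phi> p w\<close> are vertices, and strict convexity gives
  \<open>w = p\<close>.\<close>

lemma touch_line:
  assumes t: "touch a b p q" and w: "w \<in> K" "side a b p w = 0"
  shows "w = p"
proof -
  have p: "p \<in> V" using t by (simp add: touch_def)
  have "\<phi> p w \<in> V"
    using touch_line_in_V[OF t phi_K[OF p w(1)]] side_phi[of a b p w] w(2) by simp
  then show ?thesis using phi_in_V_imp_eq[OF p touch_line_in_V[OF t w]] by simp
qed

text \<open>Both chords are the vector \<open>(L - 1) * (a - b)\<close>, so \<open>p\<close> and
  \<open>p'\<close> have the same projection onto it, and the line through \<open>p\<close> meets
  \<open>K\<close> only in \<open>p\<close>.\<close>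

lemma touch_unique:
  assumes "touch a b p q" "touch a b p' q'" shows "p' = p" "q' = q"
proof -
  have V: "p \<in> V" "q \<in> V" "p' \<in> V" "q' \<in> V" using assms by (auto simp: touch_def)
  define D where "D = a - b"
  have D: "q - p = of_real (L - 1) * D" "q' - p' = of_real (L - 1) * D"
    using assms touch_diff unfolding D_def by blast+
  then have "Re (p * cnj (q - p)) = Re (p' * cnj (q' - p'))"
    unfolding Re_mult_chord[OF norm_V norm_V, OF V(1,2)] Re_mult_chord[OF norm_V norm_V, OF V(3,4)]
    by simp
  then have "(L - 1) * Re (p * cnj D) = (L - 1) * Re (p' * cnj D)"
    unfolding D by (simp add: algebra_simps)
  then have "Re (p * cnj D) = Re (p' * cnj D)" using L by simp
  then have "side a b p p' = 0" by (simp add: side_def left_diff_distrib flip: D_def)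
  then show "p' = p" using touch_line[OF assms(1)] V_subset_K assms(2) by (auto simp: touch_def)
  then show "q' = q" using assms phi_inj by (auto simp: touch_def)
qed

text \<open>Some vertex of the graph of cells is not a cut vertex, and rotations act transitively on
  the graph, so no vertex is one. A colouring is transported by the rotation \<open>c\<close> taking
  \<open>v\<close> to \<open>p\<close>.\<close>

lemma adj_noncut:
  assumes p: "p \<in> V" and col: "\<And>x y. adj x y \<Longrightarrow> x \<noteq> p \<Longrightarrow> y \<noteq> p \<Longrightarrow> (col x :: bool) = col y"
    and x: "x \<in> V" "x \<noteq> p" and y: "y \<in> V" "y \<noteq> p"
  shows "col x = col y"
proof -
  have "\<exists>v\<in>V. \<forall>col :: complex \<Rightarrow> bool. (\<forall>x y. adj x y \<longrightarrow> x \<noteq> v \<longrightarrow> y \<noteq> v \<longrightarrow> col x = col y) \<longrightarrow>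
           (\<forall>x\<in>V - {v}. \<forall>y\<in>V - {v}. col x = col y)"
    by (rule non_cut_vertex[OF finite_V p chain_adj[OF p]]) (simp_all add: adj_def)
  then obtain v where v: "v \<in> V"
    "\<forall>col :: complex \<Rightarrow> bool. (\<forall>x y. adj x y \<longrightarrow> x \<noteq> v \<longrightarrow> y \<noteq> v \<longrightarrow> col x = col y) \<longrightarrow>
           (\<forall>x\<in>V - {v}. \<forall>y\<in>V - {v}. col x = col y)"
    by (rule bexE)
  define c where "c = p / v"
  have c: "c \<in> V" "c * v = p" using root_divide[OF p v(1)] V_nz[OF v(1)] by (simp_all add: c_def)
  have nz: "c \<noteq> 0" using V_nz[OF c(1)] .
  have "col (c * s) = col (c * t)" if "adj s t" "s \<noteq> v" "t \<noteq> v" for s t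
    using col[OF adj_rotate[OF that(1) c(1)]] that(2,3) c(2) nz by auto
  then have *: "\<forall>x\<in>V - {v}. \<forall>y\<in>V - {v}. col (c * x) = col (c * y)"
    using v(2)[THEN spec, of "\<lambda>x. col (c * x)"] by blast
  have "x / c \<in> V - {v}" "y / c \<in> V - {v}"
    using root_divide[OF x(1) c(1)] root_divide[OF y(1) c(1)] x(2) y(2) nz
    unfolding c(2)[symmetric] by auto
  with * have "col (c * (x / c)) = col (c * (y / c))" by blast
  then show ?thesis using nz by simp
qed

text \<open>The line through \<open>p\<close> orthogonal to \<open>a - b\<close> meets
  \<open>K\<close> only in \<open>p\<close>. Every first-level cell other than the one at
  \<open>p\<close> therefore lies on one side, and these cells stay linked after removal of the cell
  at \<open>p\<close>.\<close>

lemma touch_pos: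
  assumes t: "touch a b p q" and w: "w \<in> V" "w \<noteq> p"
  shows "side a b p w > 0"
proof -
  have V: "a \<in> V" "b \<in> V" "p \<in> V" "q \<in> V" "a \<noteq> b" using t by (auto simp: touch_def)
  have cells: "side a b p (\<phi> c x) > 0 \<longleftrightarrow> side a b p (\<phi> c y) > 0"
    if c: "c \<in> V" "c \<noteq> p" and xy: "x \<in> K" "y \<in> K" for c x y
  proof -
    \<comment> \<open>By nesting and strict convexity, the vertex \<open>p\<close> belongs to no
      first-level cell but its own.\<close>
    have nz: "side a b p (\<phi> c z) \<noteq> 0" if "z \<in> K" for z
    proof
      assume "side a b p (\<phi> c z) = 0"
      then have "\<phi> c z = p" using touch_line[OF t phi_K[OF c(1) \<open>z \<in> K\<close>]] by simp
      then have "p \<in> \<phi> c ` K \<inter> \<phi> p ` K"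
        using that V(3) V_subset_K phi_fixed[of L p] by (metis IntI imageI subsetD)
      then have "p \<in> \<phi> c ` V" using nesting[OF c(1) V(3) c(2)] by blast
      then show False using phi_in_V_imp_eq[OF c(1)] phi_fixed[of L c] V(3) c(2) by force
    qed
    define S where "S = (\<lambda>z. side a b p (\<phi> c z)) ` K"
    have "connected S"
      unfolding S_def side_def
      by (intro connected_continuous_image connected_K continuous_intros continuous_on_phi)
    moreover have "0 \<notin> S" using nz unfolding S_def by force
    moreover have "side a b p (\<phi> c x) \<in> S" "side a b p (\<phi> c y) \<in> S" using xy by (auto simp: S_def)
    ultimately show ?thesis
      using connectedD_interval[of S _ _ 0] by (meson linorder_not_less less_imp_le)
  qed
  have col: "side a b p c > 0 \<longleftrightarrow> side a b p d > 0"
    if cd: "adj c d" "c \<noteq> p" "d \<noteq> p" for c d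
  proof (cases "c = d")
    case False
    then obtain x y where xy: "touch c d x y" using cd(1) unfolding adj_def by blast
    then have "c \<in> K" "d \<in> K" "x \<in> K" "y \<in> K" "c \<in> V" "d \<in> V" "\<phi> c x = \<phi> d y"
      using V_subset_K by (auto simp: touch_def)
    then show ?thesis using cells[of c c x] cells[of d d y] cd by (simp add: phi_fixed)
  qed simp
  \<comment> \<open>The common side is the positive one because the vertex \<open>a\<close> is on
    it: both terms of \<open>side a b p a\<close> are computed from chords.\<close>
  have "(L - 1) * Re (p * cnj (a - b)) = Re (p * cnj (q - p))"
    unfolding touch_diff[OF t] by (simp add: algebra_simps)
  also have "\<dots> < 0"
    using Re_mult_chord[OF norm_V norm_V, OF V(3,4)] touch_ne[OF t] by simp
  finally have "Re (p * cnj (a - b)) < 0" using L by (simp add: mult_less_0_iff)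
  moreover have "Re (a * cnj (b - a)) < 0"
    using Re_mult_chord[OF norm_V norm_V, OF V(1,2)] V(5) by simp
  ultimately have "side a b p a > 0" by (simp add: side_def algebra_simps)
  moreover have "a \<noteq> p" using calculation by (auto simp: side_def)
  ultimately show ?thesis
    using adj_noncut[of p "\<lambda>c. side a b p c > 0", OF V(3) col V(1) _ w] by blast
qed

end

section \<open>Labels of addresses\<close>

lemma norm_chord:
  assumes "norm p = 1" "norm q = 1" shows "(norm (q - p))\<^sup>2 = 2 - 2 * Re (q / p)"
proof -
  have "q / p = q * cnj p" using cnj_root[OF assms(1)] by simp
  then show ?thesis
    using sum_sq_one[OF assms(1)] sum_sq_one[OF assms(2)]
    unfolding cmod_power2 by (simp add: power2_eq_square algebra_simps)
qed

lemma unit_Re_eq: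
  assumes "norm z = 1" "norm w = 1" "Re z = Re w" shows "w = z \<or> w = 1 / z"
proof -
  have "(Im z)\<^sup>2 = (Im w)\<^sup>2" using sum_sq_one[OF assms(1)] sum_sq_one[OF assms(2)] assms(3) by simp
  then have "w = z \<or> w = cnj z" using assms(3) by (auto simp: power2_eq_iff complex_eq_iff)
  then show ?thesis using cnj_root[OF assms(1)] by simp
qed

text \<open>Addresses start with the largest cell. The smallest cells of depth \<open>n\<close> at a vertex \<open>p\<close> of \<open>K\<close>
  have the constant address \<open>p\<close>, which by this choice of weights gives the label
  \<open>p ^ ((m + 1) ^ n)\<close>, so that \<open>p * a ^ m = q * b ^ m\<close> makes labels agree at every depth.\<close>
fun lab :: "nat \<Rightarrow> complex list \<Rightarrow> complex \<Rightarrow> complex" where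
  "lab m [] p = p"
| "lab m (a # u) p = a ^ (m * (m + 1) ^ length u) * lab m u p"

lemma lab_replicate: "lab m (replicate n p) p = p ^ ((m + 1) ^ n)"
  by (induction n) (simp_all add: add.commute flip: power_add)

text \<open>An address acts on the labels of the vertices by one constant factor, which becomes the
  rotation of the complex.\<close>

lemma lab_eq_mult: "lab m u p = lab m u 1 * p"
  by (induction u) simp_all

section \<open>The common ratio of touching cells\<close>

context polygon_ifs
begin

text \<open>Since \<open>p - q\<close> is a positive multiple of \<open>b - a\<close>, the
  half-plane bound for the cell at \<open>b\<close> says that every other vertex is seen from
  \<open>q\<close> at an acute angle to \<open>p\<close>; division by \<open>p\<close> normalises
  this.\<close>

lemma touch_acute:
  assumes t: "touch a b p q" and z: "z \<in> V" "z \<noteq> q / p"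
  shows "Re ((z - q / p) * cnj (1 - q / p)) > 0"
proof -
  have V: "p \<in> V" "q \<in> V" using t by (simp_all add: touch_def)
  note nz = V_nz[OF V(1)]
  have "p * z \<noteq> q" using z(2) nz by (auto simp: field_simps)
  then have "side b a q (p * z) > 0"
    using touch_pos[OF touch_sym[OF t]] root_mult[OF V(1) z(1)] by simp
  then have "(L - 1) * Re ((p * z - q) * cnj (b - a)) > 0" using L by (simp add: side_def)
  also have "(L - 1) * Re ((p * z - q) * cnj (b - a)) = Re ((p * z - q) * cnj (p - q))"
    unfolding touch_diff[OF touch_sym[OF t]] by (simp add: algebra_simps)
  also have "(p * z - q) * cnj (p - q) = (p * cnj p) * ((z - q / p) * cnj (1 - q / p))"
    using nz by (simp add: field_simps)
  also have "p * cnj p = 1" using complex_norm_square[of p] norm_V[OF V(1)] by simp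
  finally show ?thesis by simp
qed

text \<open>The acute angles make \<open>p\<close> and \<open>q\<close> span a longest diagonal, so
  \<open>Re (q / p)\<close> is the same for all touching cells. As \<open>q - p\<close> is
  \<open>L - 1\<close> times \<open>a - b\<close>, the length of \<open>a - b\<close> is also the
  same, which fixes \<open>b / a\<close> up to inversion.\<close>

lemma touch_ratio:
  assumes t: "touch a b p q" and t': "touch a' b' p' q'"
  shows "b' / a' = b / a \<or> b' / a' = a / b"
proof -
  have le: "Re (q / p) \<le> Re (q' / p')" if "touch a b p q" "touch a' b' p' q'" for a b p q a' b' p' q'
  proof (rule acute_imp_Re_le)
    have V: "q / p \<in> V" "q' / p' \<in> V"
      using that root_divide[of q k p] root_divide[of q' k p'] unfolding touch_def by blast+
    then show "norm (q / p) = 1" "norm (q' / p') = 1" using norm_V by blast+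
    fix z assume "z \<in> {q' / p', cnj (q' / p')}" "z \<noteq> q / p"
    then show "Re ((z - q / p) * cnj (1 - q / p)) > 0"
      using touch_acute[OF that(1), of z] V(2) root_cnj[OF V(2)] by blast
  qed
  have scaled: "2 - 2 * Re (q / p) = (L - 1)\<^sup>2 * (2 - 2 * Re (b / a))" if t: "touch a b p q" for a b p q
  proof -
    have "norm (q - p) = (L - 1) * norm (b - a)"
      unfolding touch_diff[OF t] norm_mult norm_of_real using L by (simp add: norm_minus_commute)
    then have "(norm (q - p))\<^sup>2 = (L - 1)\<^sup>2 * (norm (b - a))\<^sup>2" by (simp add: power_mult_distrib)
    then show ?thesis using t norm_V norm_chord unfolding touch_def by metis
  qed
  have "Re (q / p) = Re (q' / p')" using le[OF t t'] le[OF t' t] by simp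
  then have "(L - 1)\<^sup>2 * (2 - 2 * Re (b / a)) = (L - 1)\<^sup>2 * (2 - 2 * Re (b' / a'))"
    using scaled[OF t] scaled[OF t'] by auto
  then have Re: "Re (b / a) = Re (b' / a')" using L by simp
  have "b / a \<in> V" "b' / a' \<in> V"
    using t t' root_divide[of b k a] root_divide[of b' k a'] unfolding touch_def by blast+
  then show ?thesis using unit_Re_eq[OF norm_V norm_V _] Re by fastforce
qed

text \<open>Neighbouring cells differ by the factor \<open>\<delta>\<close> or its inverse, so
  connectedness makes \<open>\<delta>\<close> a generator of \<open>V\<close>. The exponent
  \<open>m\<close> is read off from \<open>p0 / q0 = \<delta> ^ m\<close>.\<close>

lemma touch_twist: "\<exists>m. \<forall>a b p q. touch a b p q \<longrightarrow> p * a ^ m = q * b ^ m"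
proof (cases "\<exists>a b p q. touch a b p q")
  case True
  then obtain a0 b0 p0 q0 where t0: "touch a0 b0 p0 q0" by blast
  then have V0: "a0 \<in> V" "b0 \<in> V" "p0 \<in> V" "q0 \<in> V" unfolding touch_def by blast+
  define \<delta> where "\<delta> = b0 / a0"
  have \<delta>: "\<delta> \<in> V" using root_divide[OF V0(2,1)] by (simp add: \<delta>_def)
  have ratio: "b / a = \<delta> \<or> a / b = \<delta>" if "touch a b p q" for a b p q
    using touch_ratio[OF t0 that] V0[THEN V_nz] that V_nz
    unfolding \<delta>_def touch_def by (auto simp: field_simps)
  have gen: "\<exists>n. x = \<delta> ^ n" if "x \<in> V" for x
    using chain_adj[of 1 x, OF _ that, simplified]
  proof (induction rule: rtranclp_induct)
    case base
    show ?case by (rule exI[of _ 0]) simp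
  next
    case (step x y)
    then obtain n where n: "x = \<delta> ^ n" by blast
    show ?case
    proof (cases "x = y")
      case False
      then obtain p q where t: "touch x y p q" using step.hyps by (auto simp: adj_def)
      then have nz: "x \<noteq> 0" "y \<noteq> 0" using V_nz by (auto simp: touch_def)
      from ratio[OF t] show ?thesis
      proof
        assume "y / x = \<delta>"
        then have "y = \<delta> ^ Suc n" using n nz by (simp add: field_simps)
        then show ?thesis by blast
      next
        assume d: "x / y = \<delta>"
        have "\<delta> ^ k = 1" using \<delta> by simp
        moreover have "\<delta> ^ k = \<delta> * \<delta> ^ (k - 1)" using k by (cases k) auto
        ultimately have "y = y * (\<delta> * \<delta> ^ (k - 1))" by simp
        also have "\<dots> = x * \<delta> ^ (k - 1)" using d nz by (simp add: field_simps)
        finally have "y = \<delta> ^ (n + (k - 1))" by (simp add: n power_add)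
        then show ?thesis by blast
      qed
    qed (use n in blast)
  qed
  obtain m where m: "p0 / q0 = \<delta> ^ m" using gen[OF root_divide[OF V0(3,4)]] by blast
  \<comment> \<open>Rotating the reference contact so that \<open>a0\<close> goes to
    \<open>a\<close> gives a contact of \<open>a\<close> and \<open>b\<close>; by uniqueness it is
    the given one, so \<open>p / q = p0 / q0\<close>.\<close>
  have key: "p * a ^ m = q * b ^ m" if t: "touch a b p q" and d: "b / a = \<delta>" for a b p q
  proof -
    have V: "a \<in> V" "b \<in> V" "p \<in> V" "q \<in> V" using t unfolding touch_def by blast+
    define c where "c = a / a0"
    note nz = V_nz[OF V(1)] V_nz[OF V(4)] V_nz[OF V0(1)] V_nz[OF V0(4)]
    have "c * a0 = a" "c * b0 = b" using d nz by (simp_all add: c_def \<delta>_def field_simps)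
    then have "touch a b (c * p0) (c * q0)"
      using touch_rotate[OF t0, of c] root_divide[OF V(1) V0(1)] by (simp add: c_def)
    then have "p = c * p0" "q = c * q0" using touch_unique[OF _ t] by blast+
    then have "p / q = p0 / q0" using nz by (simp add: c_def)
    also have "\<dots> = b ^ m / a ^ m" by (simp add: m flip: d power_divide)
    finally show ?thesis using nz by (simp add: field_simps)
  qed
  have "p * a ^ m = q * b ^ m" if t: "touch a b p q" for a b p q
    using ratio[OF t] key[OF t] key[OF touch_sym[OF t]] by auto
  then show ?thesis by blast
qed blast

section \<open>Independence of the label from the address\<close>

lemma foldr_phi_K: "set u \<subseteq> V \<Longrightarrow> x \<in> K \<Longrightarrow> foldr \<phi> u x \<in> K"
  by (induction u) (auto intro: phi_K)

lemma foldr_phi_replicate: "foldr \<phi> (replicate n p) p = p"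
  by (induction n) (simp_all add: phi_fixed)

theorem lab_well_defined:
  "\<exists>m. \<forall>u v p q. length u = length v \<longrightarrow> set u \<subseteq> V \<longrightarrow> set v \<subseteq> V \<longrightarrow> p \<in> V \<longrightarrow> q \<in> V \<longrightarrow>
     foldr \<phi> u p = foldr \<phi> v q \<longrightarrow> lab m u p = lab m v q"
proof -
  obtain m where m: "\<And>a b p q. touch a b p q \<Longrightarrow> p * a ^ m = q * b ^ m"
    using touch_twist by blast
  have "lab m u p = lab m v q"
    if "length u = n" "length v = n" "set u \<subseteq> V" "set v \<subseteq> V" "p \<in> V" "q \<in> V"
      "foldr \<phi> u p = foldr \<phi> v q" for n u v p q
    using that
  proof (induction n arbitrary: u v p q)
    case (Suc n u' v' p q)
    then obtain a u b v where uv: "u' = a # u" "v' = b # v" by (metis length_Suc_conv)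
    have V: "a \<in> V" "b \<in> V" "set u \<subseteq> V" "set v \<subseteq> V" and len: "length u = n" "length v = n"
      using Suc.prems uv by auto
    note pq = Suc.prems(5,6)
    have eq: "\<phi> a (foldr \<phi> u p) = \<phi> b (foldr \<phi> v q)" using Suc.prems(7) uv by simp
    show ?case
    proof (cases "a = b")
      case True
      then have "foldr \<phi> u p = foldr \<phi> v q" using eq phi_inj by simp
      then show ?thesis using Suc.IH[OF len V(3,4) pq] len True uv by simp
    next
      case False
      define x y where "x = foldr \<phi> u p" and "y = foldr \<phi> v q"
      have xy: "x \<in> K" "y \<in> K" "\<phi> a x = \<phi> b y"
        using foldr_phi_K[OF V(3)] foldr_phi_K[OF V(4)] pq V_subset_K eq
        unfolding x_def y_def by blast+
      then have mem: "\<phi> a x \<in> \<phi> a ` K \<inter> \<phi> b ` K"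
        by (metis IntI imageI)
      then have "\<phi> a x \<in> \<phi> a ` V" "\<phi> a x \<in> \<phi> b ` V"
        using nesting[OF V(1,2) False] by blast+
      then have inV: "x \<in> V" "y \<in> V" unfolding xy(3) image_iff phi_inj
        unfolding xy(3)[symmetric] phi_inj by simp_all
      then have t: "x * a ^ m = y * b ^ m"
        using m[of a b x y] V False xy unfolding touch_def by blast
      \<comment> \<open>The remaining address leads to a vertex \<open>z\<close> of
        \<open>K\<close>, which also has the constant address \<open>z\<close>; the induction
        hypothesis compares the two.\<close>
      have vertex: "lab m w s = z ^ ((m + 1) ^ n)"
        if w: "length w = n" "set w \<subseteq> V" and s: "s \<in> V" and z: "foldr \<phi> w s = z" "z \<in> V" for w s z
      proof -
        have "set (replicate n z) \<subseteq> V" using z(2) by auto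
        moreover have "foldr \<phi> w s = foldr \<phi> (replicate n z) z" by (simp only: z(1) foldr_phi_replicate)
        ultimately have "lab m w s = lab m (replicate n z) z"
          using Suc.IH[OF w(1) length_replicate w(2) _ s z(2)] by blast
        then show ?thesis by (simp only: lab_replicate)
      qed
      have x: "lab m u p = x ^ ((m + 1) ^ n)"
        by (rule vertex[OF len(1) V(3) pq(1) x_def[symmetric] inV(1)])
      have y: "lab m v q = y ^ ((m + 1) ^ n)"
        by (rule vertex[OF len(2) V(4) pq(2) y_def[symmetric] inV(2)])
      \<comment> \<open>The weight of the first letter is \<open>m\<close> times the exponent of
        \<open>x\<close>, so the label is a power of \<open>x * a ^ m\<close>.\<close>
      have "lab m (a # u) p = (x * a ^ m) ^ ((m + 1) ^ length u)"
        by (simp add: x len power_mult power_mult_distrib mult.commute)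
      also have "\<dots> = lab m (b # v) q"
        by (simp add: t y len power_mult power_mult_distrib mult.commute)
      finally show ?thesis by (simp only: uv)
    qed
  qed simp
  then show ?thesis by blast
qed

end

section \<open>Normalisation of the fractal\<close>

text \<open>Normalised coordinates for a regular polygon with centre \<open>c\<close> that has a vertex at \<open>0\<close>,
  the fixed point of the first similitude. This vertex gets the coordinate \<open>1\<close>.\<close>
definition coord :: "complex \<Rightarrow> complex \<Rightarrow> complex" where
  "coord c w = c * (1 - w)"

lemma coord_inj: "c \<noteq> 0 \<Longrightarrow> coord c w = coord c w' \<longleftrightarrow> w = w'"
  by (simp add: coord_def)

lemma coord_phi: "coord c (phi L a w) = coord c w / L + coord c a * (1 - 1 / L)"
  by (simp add: coord_def phi_def algebra_simps diff_divide_distrib)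

lemma lab_in_roots: "set u \<subseteq> roots k \<Longrightarrow> p \<in> roots k \<Longrightarrow> lab m u p \<in> roots k"
proof (induction u)
  case (Cons a u)
  then have "a ^ (m * (m + 1) ^ length u) \<in> roots k"
    by (simp add: power_mult[symmetric] mult.commute) (simp add: power_mult)
  moreover have "lab m u p \<in> roots k" using Cons by simp
  ultimately show ?case using root_mult by simp
qed simp

lemma lab_pad: "lab m (replicate n 1 @ u) p = lab m u p"
  by (induction n) simp_all

text \<open>Since \<open>coord c 1 = 0\<close>, a leading letter \<open>1\<close> (the index of the similitude fixing \<open>0\<close>)
  does not change the complex described by an address.\<close>
lemma coord_pad:
  assumes "L \<noteq> 0"
  shows "of_real L ^ length (replicate n 1 @ u) * coord c (foldr (phi L) (replicate n 1 @ u) p) =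
    of_real L ^ length u * coord c (foldr (phi L) u p)"
proof (induction n)
  case (Suc n)
  have "coord c (phi L 1 w) = coord c w / L" for w
    unfolding coord_phi by (simp add: coord_def)
  then show ?case using Suc assms by simp
qed simp

lemma (in polygon_ifs) lab_by_point:
  assumes "c \<noteq> 0"
  shows "\<exists>m F. \<forall>u p. set u \<subseteq> V \<longrightarrow> p \<in> V \<longrightarrow>
    F (of_real L ^ length u * coord c (foldr \<phi> u p)) = lab m u p"
proof -
  obtain m where m: "\<And>u v p q. length u = length v \<Longrightarrow> set u \<subseteq> V \<Longrightarrow> set v \<subseteq> V \<Longrightarrow> p \<in> V \<Longrightarrow> q \<in> V \<Longrightarrow>
      foldr \<phi> u p = foldr \<phi> v q \<Longrightarrow> lab m u p = lab m v q"
    using lab_well_defined by blast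
  define pt where "pt u p = of_real L ^ length u * coord c (foldr \<phi> u p)" for u p
  have L0: "L \<noteq> 0" using L by simp
  have wd: "lab m u p = lab m v q"
    if "set u \<subseteq> V" "set v \<subseteq> V" "p \<in> V" "q \<in> V" "pt u p = pt v q" for u v p q
  proof -
    \<comment> \<open>Padding each address by the length of the other makes the depths equal without
      moving the points.\<close>
    define u' v' where "u' = replicate (length v) 1 @ u" and "v' = replicate (length u) 1 @ v"
    have len: "length u' = length v'" by (simp add: u'_def v'_def)
    have "pt u' p = pt v' q"
      using that(5) unfolding pt_def u'_def v'_def coord_pad[OF L0] .
    then have "foldr \<phi> u' p = foldr \<phi> v' q"
      using L0 assms by (simp add: pt_def len coord_inj)
    moreover have "set u' \<subseteq> V" "set v' \<subseteq> V" using that(1,2) by (auto simp: u'_def v'_def)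
    ultimately have "lab m u' p = lab m v' q" using m[OF len] that(3,4) by blast
    then show ?thesis by (simp only: u'_def v'_def lab_pad)
  qed
  define F where "F x = (SOME y. \<exists>u p. set u \<subseteq> V \<and> p \<in> V \<and> pt u p = x \<and> y = lab m u p)" for x
  have "F (pt u p) = lab m u p" if up: "set u \<subseteq> V" "p \<in> V" for u p
  proof -
    have "\<exists>v q. set v \<subseteq> V \<and> q \<in> V \<and> pt v q = pt u p \<and> F (pt u p) = lab m v q"
      unfolding F_def by (rule someI[of _ "lab m u p"]) (use up in blast)
    then show ?thesis using wd up by metis
  qed
  then show ?thesis unfolding pt_def by blast
qed

text \<open>If \<open>w0\<close> is the root belonging to the vertex \<open>0\<close>, division by
  \<open>w0\<close> permutes the roots and moves that vertex to coordinate \<open>1\<close>.\<close>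

lemma regular_polygon_coord:
  assumes "regular_polygon S k" "k > 0" "0 \<in> S"
  obtains c where "c \<noteq> 0" "S = coord c ` roots k"
proof -
  obtain c r \<theta> where r: "r > 0"
    and S: "S = {c + complex_of_real r * cis (\<theta> + 2 * pi * real j / real k) | j. j < k}"
    using assms(1) unfolding regular_polygon_def by blast
  define \<rho> where "\<rho> = of_real r * cis \<theta>"
  have "roots k = (\<lambda>j. cis (2 * pi * real j / real k)) ` {..<k}"
    using Complex.bij_betw_roots_unity[OF assms(2)] by (simp add: bij_betw_def)
  then have S': "S = (\<lambda>w. c + \<rho> * w) ` roots k"
    unfolding S \<rho>_def by (auto simp: cis_mult mult.assoc image_iff)
  then obtain w0 where w0: "w0 \<in> roots k" "c + \<rho> * w0 = 0" using assms(3) by force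
  have nz: "w0 \<noteq> 0" "\<rho> \<noteq> 0" using w0(1) assms(2) r by (auto simp: \<rho>_def power_0_left)
  have c: "c = - \<rho> * w0" using w0(2) by (simp add: eq_neg_iff_add_eq_0)
  have eq: "c + \<rho> * w = coord c (w / w0)" for w using nz by (simp add: c coord_def field_simps)
  have "(\<lambda>w. w / w0) ` roots k = roots k"
  proof
    show "(\<lambda>w. w / w0) ` roots k \<subseteq> roots k" using root_divide w0(1) by blast
    show "roots k \<subseteq> (\<lambda>w. w / w0) ` roots k"
    proof
      fix w assume "w \<in> roots k"
      then have "w * w0 \<in> roots k" using root_mult w0(1) by blast
      then show "w \<in> (\<lambda>w. w / w0) ` roots k" using nz by (intro image_eqI[of _ _ "w * w0"]) auto
    qed
  qed
  then have "S = coord c ` roots k"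
    unfolding S' eq by (metis image_image)
  moreover have "c \<noteq> 0" using c nz by simp
  ultimately show ?thesis using that by blast
qed

text \<open>The number in the hypothesis is the fixed point of \<open>Psi L \<nu> i\<close>, and
  both similitudes have ratio \<open>1 / L\<close>.\<close>

lemma Psi_eq_coord:
  assumes "L > 1" "coord c a = \<nu> i * of_real L / of_real (L - 1)"
  shows "Psi L \<nu> i (coord c w) = coord c (phi L a w)"
proof -
  have "of_real L \<noteq> (1 :: complex)" using assms(1) by simp
  then have "coord c a * (1 - 1 / L) = \<nu> i"
    using assms by (simp add: field_simps)
  then show ?thesis unfolding coord_phi by (simp add: Psi_def)
qed

lemma fixed_points_eq:
  assumes "L > 1"
  shows "fixed_points L N \<nu> = (\<lambda>i. \<nu> i * of_real L / of_real (L - 1)) ` {1..N}"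
proof -
  have "Psi L \<nu> i x = x \<longleftrightarrow> x = \<nu> i * of_real L / of_real (L - 1)" for i x
  proof -
    have "of_real L \<noteq> (1 :: complex)" "of_real L \<noteq> (0 :: complex)" using assms by auto
    then show ?thesis by (auto simp: Psi_def field_simps)
  qed
  then show ?thesis unfolding fixed_points_def by auto
qed

text \<open>Magnifying a cell of depth \<open>n\<close> by \<open>L ^ n\<close> gives a complex of
  order \<open>0\<close>. The list is reversed because the highest power of \<open>L\<close> belongs
  to the largest cell, where addresses start.\<close>

lemma coord_address:
  assumes "L > 1"
    and pos: "\<And>j x. coord c (phi L (pos (w j)) x) = coord c x / L + \<nu> (w j)"
  shows "coord c x + (\<Sum>j\<in>{1..int n}. of_real (L powi j) * \<nu> (w j)) =
    of_real L ^ n * coord c (foldr (phi L) (rev (map (\<lambda>j. pos (w (int (Suc j)))) [0..<n])) x)"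
proof (induction n)
  case (Suc n)
  define S y where "S = (\<Sum>j\<in>{1..int n}. of_real (L powi j) * \<nu> (w j))"
    and "y = coord c (foldr (phi L) (rev (map (\<lambda>j. pos (w (int (Suc j)))) [0..<n])) x)"
  have "{1..int (Suc n)} = insert (int (Suc n)) {1..int n}" by auto
  then have "(\<Sum>j\<in>{1..int (Suc n)}. of_real (L powi j) * \<nu> (w j)) =
      of_real (L ^ Suc n) * \<nu> (w (int (Suc n))) + S"
    by (simp del: of_nat_Suc power_Suc add: S_def)
  then have "coord c x + (\<Sum>j\<in>{1..int (Suc n)}. of_real (L powi j) * \<nu> (w j)) =
      (coord c x + S) + of_real (L ^ Suc n) * \<nu> (w (int (Suc n)))"
    by (simp only: ac_simps)
  also have "coord c x + S = of_real L ^ n * y" unfolding S_def y_def by (rule Suc)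
  also have "\<dots> + of_real (L ^ Suc n) * \<nu> (w (int (Suc n))) =
      of_real L ^ Suc n * (y / of_real L + \<nu> (w (int (Suc n))))"
    using assms(1) by (simp add: field_simps)
  also have "y / of_real L + \<nu> (w (int (Suc n))) =
      coord c (foldr (phi L) (rev (map (\<lambda>j. pos (w (int (Suc j)))) [0..<Suc n])) x)"
    by (simp add: pos y_def del: of_nat_Suc)
  finally show ?case .
qed simp

theorem theorem3p13:
  fixes L :: real and N :: nat and \<nu> :: "nat \<Rightarrow> complex" and K :: "complex set"
  assumes "simple_nested_fractal L N \<nu> K"
    and "regular_polygon (V0 L N \<nu>) (card (V0 L N \<nu>))"
    and "card (V0 L N \<nu>) \<ge> 3"
    and "card (V0 L N \<nu>) = N"
  shows "good_labelling_property L N \<nu>"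
proof -
  note snf = assms(1)[unfolded simple_nested_fractal_def]
  have L: "L > 1" and nu1: "\<nu> 1 = 0" and N3: "N \<ge> 3" using snf assms(3,4) by auto
  have K: "compact K" "K \<noteq> {}" "K = (\<Union>i\<in>{1..N}. Psi L \<nu> i ` K)"
    and nest: "\<forall>w w'. length w = length w' \<and> set w \<subseteq> {1..N} \<and> set w' \<subseteq> {1..N} \<and> w \<noteq> w' \<longrightarrow>
        Psi_word L \<nu> w ` K \<inter> Psi_word L \<nu> w' ` K =
        Psi_word L \<nu> w ` V0 L N \<nu> \<inter> Psi_word L \<nu> w' ` V0 L N \<nu>"
    and conn: "\<forall>i\<in>{1..N}. \<forall>j\<in>{1..N}.
        (\<lambda>a b. a \<in> {1..N} \<and> b \<in> {1..N} \<and> Psi L \<nu> a ` K \<inter> Psi L \<nu> b ` K \<noteq> {})\<^sup>*\<^sup>* i j"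
    using snf by - (elim conjE, assumption)+
  define fp where "fp i = \<nu> i * of_real L / of_real (L - 1)" for i
  have fpts: "fixed_points L N \<nu> = fp ` {1..N}"
    unfolding fp_def by (rule fixed_points_eq[OF L])
  have "V0 L N \<nu> \<subseteq> fixed_points L N \<nu>" unfolding V0_def by blast
  moreover have "card (fixed_points L N \<nu>) \<le> N"
    unfolding fpts using card_image_le[of "{1..N}" fp] by simp
  \<comment> \<open>There are at most \<open>N\<close> fixed points and \<open>N\<close> of them are
    essential, so the two sets coincide.\<close>
  ultimately have V0_eq: "V0 L N \<nu> = fp ` {1..N}"
    using assms(4) fpts by (metis card_seteq finite_atLeastAtMost finite_imageI)
  have "0 \<in> V0 L N \<nu>" unfolding V0_eq using N3 nu1 by (intro image_eqI[of _ _ 1]) (auto simp: fp_def)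
  then obtain c where c: "c \<noteq> 0" and V0_coord: "V0 L N \<nu> = coord c ` roots N"
    using regular_polygon_coord[of "V0 L N \<nu>" N] assms(2,4) N3 by auto
  define pos where "pos i = 1 - fp i / c" for i
  have pos: "coord c (pos i) = fp i" for i using c by (simp add: coord_def pos_def)
  have comm: "Psi L \<nu> i (coord c x) = coord c (phi L (pos i) x)" for i x
    by (rule Psi_eq_coord[OF L]) (simp add: pos fp_def)
  have pos_image: "pos ` {1..N} = roots N"
  proof -
    have "coord c ` pos ` {1..N} = coord c ` roots N"
      using V0_eq V0_coord by (simp add: image_image pos)
    then show ?thesis using coord_inj[OF c] by (metis inj_def inj_image_eq_iff)
  qed
  then have pos_root: "pos i \<in> roots N" if "i \<in> {1..N}" for i using that by blast
  \<comment> \<open>This is the preimage of \<open>K\<close> under \<open>coord c\<close>.\<close>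
  define K' where "K' = (\<lambda>x. 1 - x / c) ` K"
  have coord_K': "coord c ` K' = K" unfolding K'_def image_image using c by (simp add: coord_def)
  have cell: "Psi L \<nu> i ` K = coord c ` phi L (pos i) ` K'" for i
    by (simp add: image_image comm flip: coord_K')
  have coord_Int: "coord c ` A \<inter> coord c ` B = coord c ` (A \<inter> B)" for A B
    using coord_inj[OF c] by (auto simp: inj_def image_Int)
  have inj_coord: "inj (coord c)" using coord_inj[OF c] by (simp add: inj_def)
  interpret polygon_ifs L N K'
  proof
    show "L > 1" "N \<ge> 3" by fact+
    show "compact K'" unfolding K'_def using K(1) c by (intro compact_continuous_image continuous_intros) auto
    show "K' \<noteq> {}" unfolding K'_def using K(2) by simp
    have "coord c ` K' = (\<Union>i\<in>{1..N}. coord c ` phi L (pos i) ` K')"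
      unfolding coord_K' cell[symmetric] by (rule K(3))
    also have "\<dots> = coord c ` (\<Union>a\<in>pos ` {1..N}. phi L a ` K')" by (simp add: image_UN)
    finally show "K' = (\<Union>a\<in>roots N. phi L a ` K')"
      by (simp only: inj_image_eq_iff[OF inj_coord] pos_image)
  next
    fix a b assume ab: "a \<in> roots N" "b \<in> roots N" "a \<noteq> b"
    then obtain i j where ij: "i \<in> {1..N}" "j \<in> {1..N}" "a = pos i" "b = pos j" "i \<noteq> j"
      using pos_image by blast
    then have "Psi_word L \<nu> [i] ` K \<inter> Psi_word L \<nu> [j] ` K =
        Psi_word L \<nu> [i] ` V0 L N \<nu> \<inter> Psi_word L \<nu> [j] ` V0 L N \<nu>"
      by (intro nest[rule_format]) auto
    then have "Psi L \<nu> i ` K \<inter> Psi L \<nu> j ` K = Psi L \<nu> i ` V0 L N \<nu> \<inter> Psi L \<nu> j ` V0 L N \<nu>"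
      by (simp add: Psi_word_def)
    moreover have "Psi L \<nu> i ` V0 L N \<nu> = coord c ` phi L (pos i) ` roots N" for i
      by (simp only: V0_coord image_image comm)
    ultimately have "coord c ` (phi L a ` K' \<inter> phi L b ` K') = coord c ` (phi L a ` roots N \<inter> phi L b ` roots N)"
      by (simp only: cell coord_Int ij(3,4))
    then show "phi L a ` K' \<inter> phi L b ` K' \<subseteq> phi L a ` roots N \<inter> phi L b ` roots N"
      by (simp only: inj_image_eq_iff[OF inj_coord])
  next
    fix a b assume ab: "a \<in> roots N" "b \<in> roots N"
    then obtain i j where ij: "i \<in> {1..N}" "j \<in> {1..N}" "a = pos i" "b = pos j"
      using pos_image by blast
    show "(\<lambda>a b. a \<in> roots N \<and> b \<in> roots N \<and> phi L a ` K' \<inter> phi L b ` K' \<noteq> {})\<^sup>*\<^sup>* a b"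
      unfolding ij(3,4) using conn[rule_format, OF ij(1,2)]
    proof (induction rule: rtranclp_induct)
      case (step i j)
      then have "phi L (pos i) ` K' \<inter> phi L (pos j) ` K' \<noteq> {}"
        unfolding cell coord_Int by blast
      moreover have "pos i \<in> roots N" "pos j \<in> roots N" using step.hyps(2) pos_root by blast+
      ultimately show ?case by (intro rtranclp.rtrancl_into_rtrancl[OF step.IH] conjI)
    qed simp
  qed
  obtain m F where F: "\<forall>u p. set u \<subseteq> roots N \<longrightarrow> p \<in> roots N \<longrightarrow>
      F (of_real L ^ length u * coord c (foldr (phi L) u p)) = lab m u p"
    using lab_by_point[OF c] by (elim exE)
  have F_coord: "F (coord c p) = p" if "p \<in> roots N" for p
    using F[rule_format, of "[]" p] that by simp
  obtain enc where enc: "bij_betw enc (roots N) {..<N}"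
    using ex_bij_betw_finite_nat[OF finite_V] card_V by (auto simp: atLeast0LessThan)
  define labelling where "labelling v = enc (F v)" for v
  have VMM0: "VMM L N \<nu> 0 = coord c ` roots N" by (simp add: VMM_def V0_coord)
  have shift: "\<exists>u. set u \<subseteq> roots N \<and> (\<forall>p\<in>roots N. F (coord c p + s) = lab m u p)"
    if s: "s \<in> complex_shifts L N \<nu> 0" for s
  proof -
    obtain J w where J: "J \<ge> 1" and w: "\<And>j. w j \<in> {1..N}"
      and s_eq: "s = (\<Sum>j\<in>{1..J}. of_real (L powi j) * \<nu> (w j))"
      using s unfolding complex_shifts_def by auto
    define u where "u = rev (map (\<lambda>j. pos (w (int (Suc j)))) [0..<nat J])"
    have u: "set u \<subseteq> roots N" "length u = nat J" unfolding u_def using w pos_root by auto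
    have "coord c p + s = of_real L ^ length u * coord c (foldr (phi L) u p)" for p
      using coord_address[OF L, of c pos w \<nu> p "nat J"] J
      unfolding s_eq u(2) unfolding u_def by (simp add: Psi_def flip: comm)
    then have "F (coord c p + s) = lab m u p" if "p \<in> roots N" for p
      using F[rule_format, OF u(1) that] by simp
    then show ?thesis using u(1) by blast
  qed
  have bary: "barycenter_M L N \<nu> 0 = c"
  proof -
    \<comment> \<open>The roots of unity sum to zero, so the barycenter is the centre
      \<open>c\<close>.\<close>
    have "(\<Sum>v\<in>coord c ` roots N. v) = (\<Sum>p\<in>roots N. c - c * p)"
      by (subst sum.reindex[OF inj_on_subset[OF inj_coord subset_UNIV]])
        (simp add: coord_def right_diff_distrib)
    also have "\<dots> = of_nat N * c - c * \<Sum>(roots N)"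
      by (simp add: sum_subtractf card_V flip: sum_distrib_left)
    also have "\<dots> = of_nat N * c" using sum_roots_unity[of N] N3 by simp
    finally show ?thesis
      using N3 assms(4) by (simp add: barycenter_M_def VMM0 V0_coord)
  qed
  have "good_labelling_function L N \<nu> {..<card (V0 L N \<nu>)} 0 labelling"
    unfolding good_labelling_function_def
  proof (intro conjI ballI)
    fix v assume "v \<in> VM_inf L N \<nu> 0"
    then obtain s p where s: "s \<in> complex_shifts L N \<nu> 0" and p: "p \<in> roots N" "v = coord c p + s"
      unfolding VM_inf_def complex_vertices_def VMM0 by blast
    then obtain u where "set u \<subseteq> roots N" "F v = lab m u p" using shift by blast
    then have "F v \<in> roots N" using lab_in_roots p(1) by metis
    then have "enc (F v) \<in> {..<N}" using bij_betwE[OF enc] by blast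
    then show "labelling v \<in> {..<card (V0 L N \<nu>)}" by (simp only: labelling_def assms(4))
  next
    have "bij_betw F (coord c ` roots N) (roots N)"
      by (rule bij_betw_byWitness[where f' = "coord c"]) (auto simp: F_coord)
    then have "bij_betw (enc \<circ> F) (coord c ` roots N) {..<N}" by (rule bij_betw_trans[OF _ enc])
    moreover have "enc \<circ> F = labelling" by (simp add: labelling_def fun_eq_iff)
    ultimately show "bij_betw labelling (VMM L N \<nu> 0) {..<card (V0 L N \<nu>)}"
      by (simp only: VMM0 assms(4))
  next
    fix s assume s: "s \<in> complex_shifts L N \<nu> 0"
    then obtain u where u: "set u \<subseteq> roots N" "\<And>p. p \<in> roots N \<Longrightarrow> F (coord c p + s) = lab m u p"
      using shift by blast
    \<comment> \<open>The rotation is by the label that the address gives to the vertex with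
      coordinate \<open>1\<close>.\<close>
    define \<omega> where "\<omega> = lab m u 1"
    have \<omega>: "\<omega> \<in> roots N" unfolding \<omega>_def by (rule lab_in_roots[OF u(1)]) simp
    define R where "R = (\<lambda>z. c + \<omega> * (z - c))"
    have R: "R (coord c p) = coord c (\<omega> * p)" for p by (simp add: R_def coord_def algebra_simps)
    have "(\<lambda>p. \<omega> * p) ` roots N = roots N"
    proof
      show "(\<lambda>p. \<omega> * p) ` roots N \<subseteq> roots N" using root_mult \<omega> by blast
      show "roots N \<subseteq> (\<lambda>p. \<omega> * p) ` roots N"
      proof
        fix p assume "p \<in> roots N"
        then have "p / \<omega> \<in> roots N" using root_divide \<omega> by blast
        then show "p \<in> (\<lambda>p. \<omega> * p) ` roots N"
          using V_nz[OF \<omega>] by (intro image_eqI[of _ _ "p / \<omega>"]) auto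
      qed
    qed
    then have "coord c ` (\<lambda>p. \<omega> * p) ` roots N = coord c ` roots N" by (rule arg_cong)
    then have "R ` VMM L N \<nu> 0 = VMM L N \<nu> 0" by (simp only: VMM0 image_image R)
    then have "R \<in> rotations_M L N \<nu> 0"
      unfolding rotations_M_def bary
      by (intro CollectI exI[of _ \<omega>] conjI norm_V[OF \<omega>] R_def)
    moreover have "labelling v = labelling (R (v - s))" if v: "v \<in> complex_vertices L N \<nu> 0 s" for v
    proof -
      obtain p where p: "p \<in> roots N" "v = coord c p + s"
        using v unfolding complex_vertices_def VMM0 by blast
      have "F v = \<omega> * p" unfolding \<omega>_def p(2) u(2)[OF p(1)] by (rule lab_eq_mult)
      also have "\<dots> = F (R (v - s))" using F_coord[OF root_mult[OF \<omega> p(1)]] by (simp add: p(2) R)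
      finally show ?thesis by (simp add: labelling_def)
    qed
    ultimately show "\<exists>R\<in>rotations_M L N \<nu> 0. \<forall>v\<in>complex_vertices L N \<nu> 0 s. labelling v = labelling (R (v - s))"
      by blast
  qed
  then show ?thesis unfolding good_labelling_property_def by blast
qed

end
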